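(* Let $X$ be a path-connected ANR space. Then $$\mathsf{TC}^{FH}(X)=\mathsf{TC}^{FH}_g(X)=\mathsf{TC}^{DM}(X)=\mathsf{TC}^{M}(X)=\mathsf{TC}^M_g(X).$$
   Context: An ANR is a metrizable space $X$ such that every continuous map $f\colon A\to X$ from a closed subset $A$ of a metrizable space $Y$ extends continuously over an open neighborhood of $A$ in $Y$. Let $e_{01}\colon X^{[0,1]}\to X\times X$, $\gamma\mapsto(\gamma(0),\gamma(1))$, $\Delta X=\{(x,x):x\in X\}$, and $c_x$ the constant path at $x$. All invariants below are the least nonnegative integer $n$ for which the described structure exists, and $\infty$ if none exists: (i) $\mathsf{TC}^M(X)$: an open cover $\{U_0,\ldots,U_n\}$ of $X\times X$ with $\Delta X\subseteq U_i$ for every $i$, and continuous sections $s_i\colon U_i\to X^{[0,1]}$ of $e_{01}$ with $s_i(x,x)=c_x$ for all $x$. (ii) $\mathsf{TC}^M_g(X)$: same as (i) but the sets $U_i$ need not be open. (iii) $\mathsf{TC}^{DM}(X)$: an open cover $\{U_0,\ldots,U_n\}$ of $X\times X$ with continuous sections $s_i\colon U_i\to X^{[0,1]}$ of $e_{01}$ such that $s_i(x,x)=c_x$ whenever $(x,x)\in U_i$. (iv) $\mathsf{TC}^{FH}(X)$: an open cover $\{U_0,\ldots,U_n\}$ of $X\times X$ with continuous sections $s_i\colon U_i\to X^{[0,1]}$ of $e_{01}$ such that $\Delta X\subseteq U_0$, $s_0(x,x)=c_x$ for all $x\in X$, and $\Delta X\cap U_i=\varnothing$ for all $i\ge1$.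 (v) $\mathsf{TC}^{FH}_g(X)$: same as (iv) but the sets $U_i$ need not be open. *)

theory Defs
  imports "HOL-Analysis.Analysis" "HOL-Library.Extended_Nat"
begin

definition ANE_wrt :: "'b itself \<Rightarrow> 'a topology \<Rightarrow> bool" where
  "ANE_wrt (_::'b itself) X \<longleftrightarrow>
     (\<forall>(Y::'b topology) A f.
        metrizable_space Y \<and> closedin Y A \<and> continuous_map (subtopology Y A) X f \<longrightarrow>
        (\<exists>U g. openin Y U \<and> A \<subseteq> U \<and> continuous_map (subtopology Y U) X g \<and>
               (\<forall>y\<in>A. g y = f y)))"

definition ANR_space :: "'a topology \<Rightarrow> bool" where
  "ANR_space X \<longleftrightarrow> metrizable_space X \<and> ANE_wrt TYPE('a \<Rightarrow> real) X"

definition paths :: "'a topology \<Rightarrow> (real \<Rightarrow> 'a) set" where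
  "paths X = {g. pathin X g \<and> (\<forall>t. t \<notin> {0..1} \<longrightarrow> g t = undefined)}"

definition path_space :: "'a topology \<Rightarrow> (real \<Rightarrow> 'a) topology" where
  "path_space X = topology_generated_by
     {{g \<in> paths X. g ` K \<subseteq> V} | K V. compact K \<and> K \<subseteq> {0..1} \<and> openin X V}"

definition const_path :: "'a \<Rightarrow> real \<Rightarrow> 'a" where
  "const_path x = (\<lambda>t. if t \<in> {0..1} then x else undefined)"

definition motion_section :: "'a topology \<Rightarrow> ('a \<times> 'a) set \<Rightarrow> ('a \<times> 'a \<Rightarrow> real \<Rightarrow> 'a) \<Rightarrow> bool" where
  "motion_section X U s \<longleftrightarrow>
     continuous_map (subtopology (prod_topology X X) U) (path_space X) s \<and>
     (\<forall>x y. (x, y) \<in> U \<longrightarrow> s (x, y) 0 = x \<and> s (x, y) 1 = y)"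

definition is_cover :: "'a topology \<Rightarrow> nat \<Rightarrow> (nat \<Rightarrow> ('a \<times> 'a) set) \<Rightarrow> bool" where
  "is_cover X n U \<longleftrightarrow> (\<forall>i\<le>n. U i \<subseteq> topspace (prod_topology X X)) \<and>
                       (\<Union>i\<le>n. U i) = topspace (prod_topology X X)"

definition diag :: "'a topology \<Rightarrow> ('a \<times> 'a) set" where
  "diag X = {(x, x) | x. x \<in> topspace X}"

definition least_enat :: "(nat \<Rightarrow> bool) \<Rightarrow> enat" where
  "least_enat P = (if \<exists>n. P n then enat (LEAST n. P n) else \<infinity>)"

definition TC_M :: "'a topology \<Rightarrow> enat" where
  "TC_M X = least_enat (\<lambda>n. \<exists>U s. is_cover X n U \<and>
     (\<forall>i\<le>n. openin (prod_topology X X) (U i) \<and> diag X \<subseteq> U i \<and>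
             motion_section X (U i) (s i) \<and>
             (\<forall>x\<in>topspace X. s i (x, x) = const_path x)))"

definition TC_M_g :: "'a topology \<Rightarrow> enat" where
  "TC_M_g X = least_enat (\<lambda>n. \<exists>U s. is_cover X n U \<and>
     (\<forall>i\<le>n. diag X \<subseteq> U i \<and>
             motion_section X (U i) (s i) \<and>
             (\<forall>x\<in>topspace X. s i (x, x) = const_path x)))"

definition TC_DM :: "'a topology \<Rightarrow> enat" where
  "TC_DM X = least_enat (\<lambda>n. \<exists>U s. is_cover X n U \<and>
     (\<forall>i\<le>n. openin (prod_topology X X) (U i) \<and>
             motion_section X (U i) (s i) \<and>
             (\<forall>x. (x, x) \<in> U i \<longrightarrow> s i (x, x) = const_path x)))"

definition TC_FH :: "'a topology \<Rightarrow> enat" where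
  "TC_FH X = least_enat (\<lambda>n. \<exists>U s. is_cover X n U \<and>
     (\<forall>i\<le>n. openin (prod_topology X X) (U i) \<and> motion_section X (U i) (s i)) \<and>
     diag X \<subseteq> U 0 \<and> (\<forall>x\<in>topspace X. s 0 (x, x) = const_path x) \<and>
     (\<forall>i. 1 \<le> i \<and> i \<le> n \<longrightarrow> diag X \<inter> U i = {}))"

definition TC_FH_g :: "'a topology \<Rightarrow> enat" where
  "TC_FH_g X = least_enat (\<lambda>n. \<exists>U s. is_cover X n U \<and>
     (\<forall>i\<le>n. motion_section X (U i) (s i)) \<and>
     diag X \<subseteq> U 0 \<and> (\<forall>x\<in>topspace X. s 0 (x, x) = const_path x) \<and>
     (\<forall>i. 1 \<le> i \<and> i \<le> n \<longrightarrow> diag X \<inter> U i = {}))"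

end

theory Submission
  imports Defs
begin

text \<open>
  Every section over an arbitrary set \<open>A \<subseteq> X \<times> X\<close>, normalised on the diagonal, can be replaced by one
  over an open neighbourhood of \<open>A\<close>. To see this, thicken \<open>X \<times> X\<close> by a parameter \<open>\<tau> \<in> [0,1]\<close> and
  remove the points with \<open>\<tau> = 0\<close> lying outside \<open>A\<close>. In the remaining metrizable space the section
  (at \<open>\<tau> = 0\<close>), the end point conditions and the constant paths over the diagonal (at every \<open>\<tau>\<close>)
  together form a continuous map on a closed set, although \<open>A\<close> is not closed. Extend it to a
  neighbourhood by the ANR property and restrict the extension to the graph \<open>\<tau> = \<delta>(x, y)\<close> of a
  small positive function.

  Hence openness is irrelevant in all the invariants. Given a cover as in \<open>TC_DM\<close>, shrink it to a
  closed cover \<open>C\<^sub>0, \<dots>, C\<^sub>n\<close>: the sections on \<open>C\<^sub>i\<close> and on the diagonal glue along closed sets, so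
  \<open>C\<^sub>i \<union> \<Delta>\<close> is a cover as in \<open>TC_M_g\<close>, while \<open>C\<^sub>0 \<union> \<Delta>\<close> and the \<open>C\<^sub>i - \<Delta>\<close> form one as in \<open>TC_FH_g\<close>.
\<close>

abbreviation unit_top :: "real topology" where
  "unit_top \<equiv> top_of_set {0..1}"

subsection \<open>Metrizable spaces\<close>

text \<open>The tube lemma as a statement about slices. It gives continuity into the compact-open
  topology and later makes a neighbourhood uniform in the path parameter.\<close>

lemma openin_slices:
  assumes W: "openin (prod_topology X Y) W" and K: "compactin Y K"
  shows "openin X {x \<in> topspace X. \<forall>y\<in>K. (x, y) \<in> W}"
proof (subst openin_subopen, intro ballI)
  fix x assume "x \<in> {x \<in> topspace X. \<forall>y\<in>K. (x, y) \<in> W}"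
  then obtain U V where "openin X U" "x \<in> U" "K \<subseteq> V" "U \<times> V \<subseteq> W"
    using tube_lemma_right[OF W K, of x] by auto
  then show "\<exists>T. openin X T \<and> x \<in> T \<and> T \<subseteq> {x \<in> topspace X. \<forall>y\<in>K. (x, y) \<in> W}"
    by (intro exI[of _ U]) (auto dest: openin_subset)
qed

text \<open>Take \<open>\<delta> m\<close> to be half the distance from \<open>(m, 0)\<close> to the
  complement of \<open>G\<close>, truncated at 1. Moving up by less than the full distance cannot
  leave \<open>G\<close>.\<close>

lemma collar_function:
  assumes "metrizable_space M" and G: "openin (prod_topology M unit_top) G"
  obtains \<delta> where "continuous_map M euclideanreal \<delta>"
    and "\<And>m. m \<in> topspace M \<Longrightarrow> 0 \<le> \<delta> m \<and> \<delta> m \<le> 1"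
    and "\<And>m. (m, 0) \<in> G \<Longrightarrow> 0 < \<delta> m"
    and "\<And>m. \<lbrakk>m \<in> topspace M; 0 < \<delta> m\<rbrakk> \<Longrightarrow> (m, \<delta> m) \<in> G"
proof -
  obtain S d where "Metric_space S d" and M: "M = Metric_space.mtopology S d"
    using assms metrizable_space_def by blast
  then interpret Metric_space S d by simp
  \<comment> \<open>\<open>Inf (B m)\<close> is this truncated distance for the sum metric on the
    product. The inserted 1 is the truncation and keeps the set nonempty when \<open>G\<close> is
    the whole space.\<close>
  define B where "B m = insert 1 {d m y + c | y c. y \<in> S \<and> c \<in> {0..1} \<and> (y, c) \<notin> G}" for m
  have B_nonneg: "0 \<le> b" if "b \<in> B m" for b m
    using that by (auto simp: B_def)
  then have bdd: "bdd_below (B m)" and ne: "B m \<noteq> {}" for m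
    by (meson bdd_below.I) (simp add: B_def)
  have Inf_ge: "c \<le> Inf (B m) \<longleftrightarrow> (\<forall>b\<in>B m. c \<le> b)" for c m
    using bdd ne by (simp add: le_cInf_iff)
  have Inf_le: "Inf (B m) \<le> b" if "b \<in> B m" for b m
    using cInf_lower[OF that bdd] .
  have Inf_le1: "Inf (B m) \<le> 1" for m
    by (intro Inf_le) (simp add: B_def)
  have Lip: "Inf (B x) - d x y \<le> Inf (B y)" if "x \<in> S" "y \<in> S" for x y
    unfolding Inf_ge
  proof
    fix b assume "b \<in> B y"
    then consider "b = 1" | z c where "b = d y z + c" "z \<in> S" "c \<in> {0..1}" "(z, c) \<notin> G"
      by (auto simp: B_def)
    then show "Inf (B x) - d x y \<le> b"
    proof cases
      case 1
      then show ?thesis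
        using Inf_le1[of x] nonneg[of x y] by linarith
    next
      case 2
      then have "Inf (B x) \<le> d x z + c"
        by (intro Inf_le) (auto simp: B_def)
      then show ?thesis
        using triangle[of x y z] that 2 by simp
    qed
  qed
  have cont: "continuous_map M euclideanreal (\<lambda>m. Inf (B m))"
  proof -
    have "\<bar>Inf (B x) - Inf (B y)\<bar> \<le> d x y" if "x \<in> S" "y \<in> S" for x y
      using Lip[OF that] Lip[OF that(2,1)] by (simp add: commute abs_le_iff)
    then have "\<exists>e>0. \<forall>y. y \<in> S \<and> d x y < e \<longrightarrow> dist (Inf (B x)) (Inf (B y)) < r"
      if "x \<in> S" "0 < r" for x r
      using that by (intro exI[of _ r]) (auto simp: dist_real_def intro: le_less_trans)
    then show ?thesis
      unfolding M
      using metric_continuous_map[OF Met_TC.Metric_space_axioms, where f="\<lambda>m. Inf (B m)"] by simp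
  qed
  show thesis
  proof
    \<comment> \<open>The point at height \<open>Inf (B m)\<close> may already lie outside
      \<open>G\<close>, so the distance is halved.\<close>
    show "continuous_map M euclideanreal (\<lambda>m. Inf (B m) / 2)"
      using cont by (intro continuous_intros) auto
    show "0 \<le> Inf (B m) / 2 \<and> Inf (B m) / 2 \<le> 1" for m
      using Inf_ge[of 0 m] B_nonneg Inf_le1[of m] by auto
    show "0 < Inf (B m) / 2" if m0: "(m, 0) \<in> G" for m
    proof -
      obtain U V where UV: "openin M U" "openin unit_top V" "m \<in> U" "0 \<in> V" "U \<times> V \<subseteq> G"
        using G m0 unfolding openin_prod_topology_alt by meson
      obtain r where r: "r > 0" "mball m r \<subseteq> U"
        using UV(1,3) unfolding M openin_mtopology by blast
      obtain e where e: "e > 0" "\<And>t. \<lbrakk>t \<in> {0..1}; dist t 0 < e\<rbrakk> \<Longrightarrow> t \<in> V"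
        using UV(2,4) unfolding openin_euclidean_subtopology_iff by blast
      have "m \<in> S"
        using UV(1,3) openin_subset M by fastforce
      \<comment> \<open>A point outside \<open>G\<close> lies outside the box
        \<open>U \<times> V\<close>, hence is at least \<open>r\<close> away in the first coordinate
        or \<open>e\<close> away in the second.\<close>
      have "min 1 (min r e) \<le> Inf (B m)"
        unfolding Inf_ge
      proof
        fix b assume "b \<in> B m"
        then consider "b = 1" | z c where "b = d m z + c" "z \<in> S" "c \<in> {0..1}" "(z, c) \<notin> G"
          by (auto simp: B_def)
        then show "min 1 (min r e) \<le> b"
        proof cases
          case 2
          then have "z \<notin> U \<or> c \<notin> V"
            using UV(5) by blast
          then have "r \<le> d m z \<or> e \<le> c"
            using r(2) e(2)[of c] 2 \<open>m \<in> S\<close> by (auto simp: not_less[symmetric] subset_iff)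
          then show ?thesis
            using 2(1,3) nonneg[of m z] by (auto simp: min_def simp del: nonneg)
        qed simp
      qed
      then show ?thesis
        using r(1) e(1) by simp
    qed
    show "(m, Inf (B m) / 2) \<in> G" if "m \<in> topspace M" "0 < Inf (B m) / 2" for m
    proof (rule ccontr)
      assume "(m, Inf (B m) / 2) \<notin> G"
      moreover have "m \<in> S"
        using that M by simp
      moreover have "Inf (B m) / 2 \<in> {0..1}"
        using that(2) Inf_le1[of m] by simp
      ultimately have "d m m + Inf (B m) / 2 \<in> B m"
        unfolding B_def[of m] by blast
      then have "Inf (B m) \<le> Inf (B m) / 2"
        using Inf_le \<open>m \<in> S\<close> by fastforce
      then show False
        using that by simp
    qed
  qed
qed

text \<open>Applied to the cylinders \<open>U i \<times> {0..1}\<close>,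
  \<open>collar_function\<close> yields functions \<open>\<delta> i\<close> that are positive
  exactly on \<open>U i\<close>.\<close>

lemma closed_shrinking:
  assumes M: "metrizable_space M" and U: "\<And>i. i \<le> (n::nat) \<Longrightarrow> openin M (U i)"
    and cov: "topspace M \<subseteq> (\<Union>i\<le>n. U i)"
  obtains C where "\<And>i. i \<le> n \<Longrightarrow> closedin M (C i)" "\<And>i. i \<le> n \<Longrightarrow> C i \<subseteq> U i"
    "(\<Union>i\<le>n. C i) = topspace M"
proof -
  have "\<exists>\<delta>. continuous_map M euclideanreal \<delta> \<and>
      (\<forall>m\<in>topspace M. 0 \<le> \<delta> m \<and> (m \<in> U i \<longleftrightarrow> 0 < \<delta> m))" if "i \<le> n" for i
  proof -
    have "openin (prod_topology M unit_top) (U i \<times> {0..1})"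
      using U[OF that] by (simp add: openin_prod_Times_iff)
    from collar_function[OF M this] show ?thesis
      by (metis SigmaE2 SigmaI atLeastAtMost_iff order_refl zero_le_one)
  qed
  then obtain \<delta> where \<delta>: "\<And>i. i \<le> n \<Longrightarrow> continuous_map M euclideanreal (\<delta> i)"
    "\<And>i m. \<lbrakk>i \<le> n; m \<in> topspace M\<rbrakk> \<Longrightarrow> 0 \<le> \<delta> i m"
    "\<And>i m. \<lbrakk>i \<le> n; m \<in> topspace M\<rbrakk> \<Longrightarrow> m \<in> U i \<longleftrightarrow> 0 < \<delta> i m"
    by metis
  \<comment> \<open>The set where \<open>\<delta> i\<close> is largest. Some
    \<open>\<delta> j\<close> is positive at each point because the \<open>U i\<close> cover, so the
    largest one is positive too.\<close>
  define C where "C i = (\<Inter>j\<le>n. {m \<in> topspace M. \<delta> i m - \<delta> j m \<in> {0..}})" for i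
  show thesis
  proof
    fix i assume i: "i \<le> n"
    show "closedin M (C i)"
      unfolding C_def
    proof (intro closedin_INT)
      fix j assume "j \<in> {..n}"
      then have "continuous_map M euclideanreal (\<lambda>m. \<delta> i m - \<delta> j m)"
        using i \<delta>(1) by (intro continuous_intros) auto
      then show "closedin M {m \<in> topspace M. \<delta> i m - \<delta> j m \<in> {0..}}"
        by (rule closedin_continuous_map_preimage) auto
    qed auto
    show "C i \<subseteq> U i"
    proof
      fix m assume m: "m \<in> C i"
      then have "m \<in> topspace M"
        by (auto simp: C_def)
      moreover obtain j where "j \<le> n" "m \<in> U j"
        using cov calculation by blast
      ultimately show "m \<in> U i"
        using m i \<delta>(3)[of j m] \<delta>(3)[of i m] by (force simp: C_def)
    qed
  next
    show "(\<Union>i\<le>n. C i) = topspace M"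
    proof
      show "topspace M \<subseteq> (\<Union>i\<le>n. C i)"
      proof
        fix m assume m: "m \<in> topspace M"
        have "Max ((\<lambda>i. \<delta> i m) ` {..n}) \<in> (\<lambda>i. \<delta> i m) ` {..n}"
          by (intro Max_in) auto
        then obtain i where "i \<le> n" "Max ((\<lambda>i. \<delta> i m) ` {..n}) = \<delta> i m"
          by (auto simp del: Max_in)
        moreover have "\<delta> j m \<le> Max ((\<lambda>i. \<delta> i m) ` {..n})" if "j \<le> n" for j
          using that by (intro Max_ge) auto
        ultimately show "m \<in> (\<Union>i\<le>n. C i)"
          using m by (auto simp: C_def)
      qed
    qed (auto simp: C_def)
  qed
qed

subsection \<open>Absolute neighbourhood extensors\<close>

text \<open>\<open>ANE_wrt\<close> speaks only of topologies on one fixed type. A space on another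
  type is reached through a homeomorphic copy of it, carried by the image of an injection.\<close>

lemma ANE_wrt_transfer:
  fixes Y :: "'c topology" and X :: "'a topology" and h :: "'c \<Rightarrow> 'b"
  assumes X: "ANE_wrt TYPE('b) X" and h: "inj_on h (topspace Y)"
    and Y: "metrizable_space Y" and A: "closedin Y A"
    and f: "continuous_map (subtopology Y A) X f"
  obtains U g where "openin Y U" "A \<subseteq> U" "continuous_map (subtopology Y U) X g"
    "\<And>y. y \<in> A \<Longrightarrow> g y = f y"
proof -
  define k where "k = inv_into (topspace Y) h"
  \<comment> \<open>Pulling the topology back along the inverse \<open>k\<close> makes
    \<open>h\<close> a homeomorphism from \<open>Y\<close> onto \<open>Y'\<close>.\<close>
  define Y' where "Y' = pullback_topology (h ` topspace Y) k Y"
  have kh: "k (h y) = y" if "y \<in> topspace Y" for y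
    using that h by (simp add: k_def)
  have Y': "topspace Y' = h ` topspace Y"
    using kh by (auto simp: Y'_def topspace_pullback_topology)
  have k: "continuous_map Y' Y k"
    unfolding Y'_def using continuous_map_pullback[OF continuous_map_id[of Y], of "h ` topspace Y" k]
    by simp
  have hc: "continuous_map Y Y' h"
    unfolding continuous_map_def Y'
  proof safe
    fix V assume "openin Y' V"
    then obtain U where "openin Y U" "V = k -` U \<inter> h ` topspace Y"
      by (auto simp: Y'_def openin_pullback_topology)
    moreover from this have "{y \<in> topspace Y. h y \<in> V} = U"
      using kh openin_subset[of Y U] by force
    ultimately show "openin Y {y \<in> topspace Y. h y \<in> V}"
      by simp
  qed auto
  have hom: "homeomorphic_maps Y Y' h k"
    using hc k kh Y' by (auto simp: homeomorphic_maps_def)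
  then have "metrizable_space Y'"
    using Y homeomorphic_metrizable_space homeomorphic_space_def by blast
  moreover have "closedin Y' (h ` A)"
    using A hom homeomorphic_map_closedness_eq homeomorphic_maps_map by blast
  moreover have "continuous_map (subtopology Y' (h ` A)) X (f \<circ> k)"
    using A[THEN closedin_subset] kh
    by (intro continuous_map_compose[OF _ f] continuous_map_into_subtopology
        continuous_map_from_subtopology k) (auto simp: subset_iff)
  ultimately obtain U' g' where U': "openin Y' U'" "h ` A \<subseteq> U'"
    "continuous_map (subtopology Y' U') X g'" "\<And>y. y \<in> A \<Longrightarrow> g' (h y) = f (k (h y))"
    using X unfolding ANE_wrt_def by (auto 0 4)
  show thesis
  proof
    show "openin Y {y \<in> topspace Y. h y \<in> U'}"
      using hc U'(1) by (rule openin_continuous_map_preimage)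
    show "A \<subseteq> {y \<in> topspace Y. h y \<in> U'}"
      using A[THEN closedin_subset] U'(2) by auto
    show "continuous_map (subtopology Y {y \<in> topspace Y. h y \<in> U'}) X (g' \<circ> h)"
      by (intro continuous_map_compose[OF _ U'(3)] continuous_map_into_subtopology
          continuous_map_from_subtopology hc) auto
    show "(g' \<circ> h) y = f y" if "y \<in> A" for y
      using that U'(4) kh A[THEN closedin_subset] by auto
  qed
qed

text \<open>Reals correspond to sets of naturals, and two such sets merge into one by using the even
  and the odd numbers.\<close>

lemma inj_real_pair:
  obtains j :: "real \<Rightarrow> real \<Rightarrow> real" where "\<And>a b c d. j a b = j c d \<longleftrightarrow> a = c \<and> b = d"
proof -
  obtain k :: "real \<Rightarrow> nat set" where k: "bij k"
    using nat_sets_eqpoll_reals eqpoll_sym unfolding eqpoll_def by blast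
  define J where "J a b = (\<lambda>n. 2 * n) ` k a \<union> (\<lambda>n. 2 * n + 1) ` k b" for a b
  have J: "k a = {n. 2 * n \<in> J a b}" "k b = {n. 2 * n + 1 \<in> J a b}" for a b
    unfolding J_def by (auto, presburger+)
  have "a = c \<and> b = d" if "J a b = J c d" for a b c d
  proof -
    have "k a = k c" "k b = k d"
      by (simp_all only: J(1)[of a b] J(1)[of c d] J(2)[of b a] J(2)[of d c] that)
    then show ?thesis
      using k by (simp add: bij_def inj_eq)
  qed
  then have "J a b = J c d \<longleftrightarrow> a = c \<and> b = d" for a b c d
    by blast
  moreover have "inj (inv k)"
    using k by (simp add: bij_imp_bij_inv bij_is_inj)
  ultimately show thesis
    by (intro that[of "\<lambda>a b. inv k (J a b)"]) (simp add: inj_eq)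
qed

text \<open>Shows that the type fixed in \<open>ANR_space\<close> can hold the thickened space used
  below. The points \<open>x\<close> and \<open>y\<close> are coded by their indicator functions,
  \<open>\<tau>\<close> and \<open>t\<close> by constants, and \<open>j\<close> packs all four into
  one real function.\<close>

lemma inj_into_real_functions:
  obtains h :: "(('a \<times> 'a) \<times> real) \<times> real \<Rightarrow> 'a \<Rightarrow> real" where "inj h"
proof -
  obtain j :: "real \<Rightarrow> real \<Rightarrow> real" where j: "\<And>a b c d. j a b = j c d \<longleftrightarrow> a = c \<and> b = d"
    using inj_real_pair by blast
  define h :: "(('a \<times> 'a) \<times> real) \<times> real \<Rightarrow> 'a \<Rightarrow> real" where
    "h = (\<lambda>(((x, y), \<tau>), t) z. j (j \<tau> t) (j (of_bool (z = x)) (of_bool (z = y))))"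
  have "inj h"
    by (rule injI) (auto simp: h_def fun_eq_iff j of_bool_eq_iff split: prod.splits)
  then show thesis ..
qed

subsection \<open>Path spaces\<close>

lemma topspace_path_space [simp]: "topspace (path_space X) = paths X"
  unfolding path_space_def topology_generated_by_topspace
proof
  \<comment> \<open>With \<open>K\<close> empty the subbasic condition is vacuous.\<close>
  have "paths X \<in> {{g \<in> paths X. g ` K \<subseteq> V} | K V. compact K \<and> K \<subseteq> {0..1} \<and> openin X V}"
    by (auto intro!: exI[of _ "{}"])
  then show "paths X \<subseteq> \<Union> {{g \<in> paths X. g ` K \<subseteq> V} | K V. compact K \<and> K \<subseteq> {0..1} \<and> openin X V}"
    by blast
qed auto

text \<open>Evaluation is continuous for the compact-open topology because each point of
  \<open>{0..1}\<close> has small compact neighbourhoods.\<close>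

lemma continuous_map_uncurry_path_space:
  assumes s: "continuous_map Z (path_space X) s"
  shows "continuous_map (prod_topology Z unit_top) X (\<lambda>(z, t). s z t)"
  unfolding continuous_map_eq_topcontinuous_at
proof
  fix p assume "p \<in> topspace (prod_topology Z unit_top)"
  then obtain z t where p: "p = (z, t)" "z \<in> topspace Z" "t \<in> {0..1}"
    by auto
  have sp: "s z \<in> paths X" if "z \<in> topspace Z" for z
    using s that continuous_map_image_subset_topspace by fastforce
  then have cont: "continuous_map unit_top X (s z)" if "z \<in> topspace Z" for z
    using that by (auto simp: paths_def pathin_def)
  show "topcontinuous_at (prod_topology Z unit_top) X (\<lambda>(z, t). s z t) p"
    unfolding topcontinuous_at_def
  proof (intro conjI allI impI)
    show "(\<lambda>(z, t). s z t) \<in> topspace (prod_topology Z unit_top) \<rightarrow> topspace X"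
      using cont by (fastforce simp: continuous_map_def)
    fix V assume V: "openin X V \<and> (\<lambda>(z, t). s z t) p \<in> V"
    have "openin unit_top {u \<in> topspace unit_top. s z u \<in> V}"
      using cont[OF p(2)] V by (blast intro: openin_continuous_map_preimage)
    then obtain e where e: "e > 0" "\<And>u. \<lbrakk>u \<in> {0..1}; dist u t < e\<rbrakk> \<Longrightarrow> s z u \<in> V"
      using p V unfolding openin_euclidean_subtopology_iff by auto
    \<comment> \<open>The half radius puts the closed ball inside the open ball of radius
      \<open>e\<close>, so \<open>s z\<close> maps all of \<open>K\<close> into
      \<open>V\<close>.\<close>
    define K where "K = {0..1} \<inter> cball t (e/2)"
    define N where "N = {g \<in> paths X. g ` K \<subseteq> V}"
    have "compact K"
      unfolding K_def by (intro compact_Int) auto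
    then have "openin (path_space X) N"
      unfolding path_space_def N_def using V
      by (intro topology_generated_by_Basis) (auto simp: K_def)
    then have "openin Z {z \<in> topspace Z. s z \<in> N}"
      using s by (blast intro: openin_continuous_map_preimage)
    moreover have "openin unit_top ({0..1} \<inter> ball t (e/2))"
      by (simp add: openin_open_Int)
    ultimately have "openin (prod_topology Z unit_top)
        ({z \<in> topspace Z. s z \<in> N} \<times> ({0..1} \<inter> ball t (e/2)))"
      by (simp add: openin_prod_Times_iff)
    moreover have "s z \<in> N"
      using sp[OF p(2)] e by (auto simp: N_def K_def dist_commute)
    moreover have "s z' t' \<in> V" if "s z' \<in> N" "t' \<in> {0..1} \<inter> ball t (e/2)" for z' t'
      using that by (auto simp: N_def K_def image_subset_iff)
    ultimately show "\<exists>U. openin (prod_topology Z unit_top) U \<and> p \<in> U \<and>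
        (\<forall>y\<in>U. (\<lambda>(z, t). s z t) y \<in> V)"
      using p e(1)
      by (intro exI[of _ "{z \<in> topspace Z. s z \<in> N} \<times> ({0..1} \<inter> ball t (e/2))"]) auto
  qed (use p in auto)
qed

text \<open>The preimage of a subbasic set is a set of slices over a compact \<open>K\<close>, open
  by \<open>openin_slices\<close>. The value \<open>undefined\<close> off \<open>{0..1}\<close> is
  the one that \<open>paths\<close> prescribes.\<close>

lemma continuous_map_curry_path_space:
  assumes F: "continuous_map (prod_topology Z unit_top) X F"
  shows "continuous_map Z (path_space X) (\<lambda>z t. if t \<in> {0..1} then F (z, t) else undefined)"
    (is "continuous_map _ _ ?s")
proof -
  have paths: "?s z \<in> paths X" if "z \<in> topspace Z" for z
  proof -
    have "continuous_map unit_top (prod_topology Z unit_top) (\<lambda>t. (z, t))"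
      using that by (intro continuous_map_pairedI) auto
    then have "continuous_map unit_top X (F \<circ> (\<lambda>t. (z, t)))"
      using F by (rule continuous_map_compose)
    then have "continuous_map unit_top X (?s z)"
      by (rule continuous_map_eq) auto
    then show ?thesis
      by (auto simp: paths_def pathin_def)
  qed
  show ?thesis
    unfolding path_space_def
  proof (rule continuous_on_generated_topo)
    fix W assume "W \<in> {{g \<in> paths X. g ` K \<subseteq> V} | K V. compact K \<and> K \<subseteq> {0..1} \<and> openin X V}"
    then obtain K V where W: "W = {g \<in> paths X. g ` K \<subseteq> V}" "compact K" "K \<subseteq> {0..1}" "openin X V"
      by blast
    have "openin (prod_topology Z unit_top) {p \<in> topspace (prod_topology Z unit_top). F p \<in> V}"
      using F W(4) by (rule openin_continuous_map_preimage)
    moreover have "compactin unit_top K"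
      using W by (simp add: compactin_subtopology)
    ultimately have "openin Z {z \<in> topspace Z. \<forall>t\<in>K.
        (z, t) \<in> {p \<in> topspace (prod_topology Z unit_top). F p \<in> V}}"
      by (rule openin_slices)
    also have "\<dots> = ?s -` W \<inter> topspace Z"
      using paths W(3) by (auto simp: W(1) image_subset_iff subset_iff)
    finally show "openin Z (?s -` W \<inter> topspace Z)" .
  next
    have "?s ` topspace Z \<subseteq> topspace (path_space X)"
      using paths by (auto simp: image_subset_iff)
    then show "?s ` topspace Z \<subseteq>
        \<Union> {{g \<in> paths X. g ` K \<subseteq> V} | K V. compact K \<and> K \<subseteq> {0..1} \<and> openin X V}"
      unfolding path_space_def topology_generated_by_topspace .
  qed
qed

subsection \<open>Motion planners normalised on the diagonal\<close>

text \<open>One condition for all five invariants: it demands constant paths everywhere on the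
  diagonal if \<open>A\<close> contains it, and adds nothing to \<open>motion_section\<close> if
  \<open>A\<close> misses it.\<close>

definition rel_section :: "'a topology \<Rightarrow> ('a \<times> 'a) set \<Rightarrow> ('a \<times> 'a \<Rightarrow> real \<Rightarrow> 'a) \<Rightarrow> bool" where
  "rel_section X A s \<longleftrightarrow> motion_section X A s \<and> (\<forall>x. (x, x) \<in> A \<longrightarrow> s (x, x) = const_path x)"

lemma motion_section_subset:
  assumes "motion_section X A s" "B \<subseteq> A"
  shows "motion_section X B s"
  using assms continuous_map_from_subtopology_mono[OF _ assms(2)]
  unfolding motion_section_def by blast

lemma rel_section_subset:
  assumes "rel_section X A s" "B \<subseteq> A"
  shows "rel_section X B s"
  using assms motion_section_subset[OF _ assms(2)] unfolding rel_section_def by blast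

lemma closedin_diag:
  assumes "metrizable_space X"
  shows "closedin (prod_topology X X) (diag X)"
proof -
  have "diag X = (\<lambda>x. (x, x)) ` topspace X"
    by (auto simp: diag_def)
  then show ?thesis
    using metrizable_imp_Hausdorff_space[OF assms] Hausdorff_space_closedin_diagonal by metis
qed

lemma rel_section_open_extension:
  fixes X :: "'a topology"
  assumes X: "ANR_space X" and A: "A \<subseteq> topspace (prod_topology X X)" and s: "rel_section X A s"
  obtains W s' where "openin (prod_topology X X) W" "A \<subseteq> W" "rel_section X W s'"
proof -
  define M where "M = prod_topology X X"
  define P where "P = prod_topology (prod_topology M unit_top) unit_top"
  \<comment> \<open>The bottom \<open>\<tau> = 0\<close> of \<open>Y\<close> lies over
    \<open>A\<close> alone, so \<open>s\<close> is defined on all of this closed set, while every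
    positive level is a full copy of \<open>M\<close> times the interval.\<close>
  define Y where "Y = subtopology P {((m, \<tau>), t). \<tau> > 0 \<or> m \<in> A}"
  \<comment> \<open>The closed pieces carrying prescribed values: the bottom, the final times, and
    the initial times together with the diagonal. The last two share a piece because
    \<open>fst m\<close> is the value required on both.\<close>
  define T where "T i = (if i = 0 then {((m, \<tau>), t) \<in> topspace Y. \<tau> = 0}
      else if i = 1 then {((m, \<tau>), t) \<in> topspace Y. t = 1}
      else {((m, \<tau>), t) \<in> topspace Y. t = 0 \<or> m \<in> diag X})" for i :: nat
  define F where "F i = (\<lambda>((m :: 'a \<times> 'a, \<tau> :: real), t :: real).
      if i = 0 then s m t else if i = 1 then snd m else fst m)" for i :: nat
  define C where "C = (\<Union>i\<in>{0,1,2}. T i)"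
  define f where "f = (\<lambda>((m :: 'a \<times> 'a, \<tau> :: real), t :: real).
      if \<tau> = 0 then s m t else if t = 1 then snd m else fst m)"
  have metr: "metrizable_space X"
    using X by (simp add: ANR_space_def)
  then have metrM: "metrizable_space M"
    by (simp add: M_def metrizable_space_prod_topology)
  then have "metrizable_space P"
    by (simp add: P_def metrizable_space_prod_topology metrizable_space_subtopology
        metrizable_space_euclidean)
  then have metrY: "metrizable_space Y"
    by (simp add: Y_def metrizable_space_subtopology)
  have topY: "((m, \<tau>), t) \<in> topspace Y \<longleftrightarrow>
      m \<in> topspace M \<and> \<tau> \<in> {0..1} \<and> t \<in> {0..1} \<and> (\<tau> > 0 \<or> m \<in> A)" for m \<tau> t
    by (auto simp: Y_def P_def)
  have cm: "continuous_map Y M (fst \<circ> fst)" and ct: "continuous_map Y unit_top snd"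
    and c\<tau>: "continuous_map Y unit_top (snd \<circ> fst)"
    unfolding Y_def P_def
    by (intro continuous_map_from_subtopology continuous_map_compose[OF continuous_map_fst]
        continuous_map_fst continuous_map_snd)+
  have clT: "closedin Y (T i)" for i
  proof -
    have "closedin Y {y \<in> topspace Y. (snd \<circ> fst) y \<in> {0}}"
      using c\<tau> by (rule closedin_continuous_map_preimage) (simp add: closed_subset)
    moreover have "closedin Y {y \<in> topspace Y. snd y \<in> {a}}" if "a \<in> {0..1}" for a
      using ct by (rule closedin_continuous_map_preimage) (use that in \<open>simp add: closed_subset\<close>)
    moreover have "closedin Y {y \<in> topspace Y. (fst \<circ> fst) y \<in> diag X}"
      using cm closedin_diag[OF metr] unfolding M_def by (rule closedin_continuous_map_preimage)
    moreover have "T i = (if i = 0 then {y \<in> topspace Y. (snd \<circ> fst) y \<in> {0}}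
        else if i = 1 then {y \<in> topspace Y. snd y \<in> {1}}
        else {y \<in> topspace Y. snd y \<in> {0}} \<union> {y \<in> topspace Y. (fst \<circ> fst) y \<in> diag X})"
      by (auto simp: T_def)
    ultimately show ?thesis
      by (auto intro: closedin_Un)
  qed
  then have clC: "closedin Y C"
    unfolding C_def by (intro closedin_Union) auto
  have sA: "s (x, y) 0 = x" "s (x, y) 1 = y" if "(x, y) \<in> A" for x y
    using s that by (auto simp: rel_section_def motion_section_def)
  have sdiag: "s (x, x) t = x" if "(x, x) \<in> A" "t \<in> {0..1}" for x t
    using s that by (auto simp: rel_section_def const_path_def)
  have Fcont: "continuous_map (subtopology Y (T i)) X (F i)" for i
  proof -
    have "continuous_map (subtopology Y (T 0)) (prod_topology (subtopology M A) unit_top)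
        (\<lambda>y. ((fst \<circ> fst) y, snd y))"
      by (intro continuous_map_pairedI continuous_map_into_subtopology
          continuous_map_from_subtopology cm ct) (auto simp: T_def topY)
    moreover have "continuous_map (prod_topology (subtopology M A) unit_top) X (\<lambda>(z, t). s z t)"
      using s by (intro continuous_map_uncurry_path_space)
        (simp add: rel_section_def motion_section_def M_def)
    ultimately have "continuous_map (subtopology Y (T 0)) X
        ((\<lambda>(z, t). s z t) \<circ> (\<lambda>y. ((fst \<circ> fst) y, snd y)))"
      by (rule continuous_map_compose)
    moreover have "(\<lambda>(z, t). s z t) \<circ> (\<lambda>y. ((fst \<circ> fst) y, snd y)) = F 0"
      by (auto simp: F_def fun_eq_iff)
    moreover have "continuous_map Y X (fst \<circ> (fst \<circ> fst))" "continuous_map Y X (snd \<circ> (fst \<circ> fst))"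
      using cm unfolding M_def
      by (blast intro: continuous_map_compose continuous_map_fst continuous_map_snd)+
    moreover have "F i = (if i = 1 then snd \<circ> (fst \<circ> fst) else fst \<circ> (fst \<circ> fst))" if "i \<noteq> 0"
      using that by (auto simp: F_def fun_eq_iff)
    ultimately show ?thesis
      by (cases "i = 0") (auto intro: continuous_map_from_subtopology)
  qed
  have "continuous_map (subtopology Y C) X f"
  proof (rule pasting_lemma_closed)
    show "closedin (subtopology Y C) (T i)" if "i \<in> {0,1,2}" for i
      using clT that by (intro closedin_subset_topspace) (auto simp: C_def)
    show "continuous_map (subtopology (subtopology Y C) (T i)) X (F i)" if "i \<in> {0,1,2}" for i
      using Fcont by (metis continuous_map_from_subtopology_mono inf_le2 subtopology_subtopology)
    \<comment> \<open>The bottom meets the other pieces compatibly by the end point conditions and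
      the normalisation of \<open>s\<close>; final times meet the diagonal where
      \<open>fst m = snd m\<close>.\<close>
    show "F i y = F j y"
      if "i \<in> {0,1,2}" "j \<in> {0,1,2}" "y \<in> topspace (subtopology Y C) \<inter> T i \<inter> T j" for i j y
      using that sA sdiag by (cases y) (auto simp: F_def T_def topY diag_def)
    show "\<exists>j. j \<in> {0,1,2} \<and> y \<in> T j \<and> f y = F j y" if "y \<in> topspace (subtopology Y C)" for y
    proof -
      obtain m \<tau> t where y: "y = ((m, \<tau>), t)"
        by (metis surj_pair)
      have "y \<in> topspace Y" "\<tau> = 0 \<or> t = 1 \<or> t = 0 \<or> m \<in> diag X"
        using that by (auto simp: y C_def T_def split: if_splits)
      then show ?thesis
        unfolding y by (intro exI[of _ "if \<tau> = 0 then 0 else if t = 1 then 1 else 2"])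
          (auto simp: F_def T_def f_def)
    qed
  qed auto
  moreover obtain h :: "(('a \<times> 'a) \<times> real) \<times> real \<Rightarrow> 'a \<Rightarrow> real" where "inj h"
    using inj_into_real_functions by blast
  moreover have "ANE_wrt TYPE('a \<Rightarrow> real) X"
    using X by (simp add: ANR_space_def)
  ultimately obtain U g where U: "openin Y U" "C \<subseteq> U" "continuous_map (subtopology Y U) X g"
    and g: "\<And>y. y \<in> C \<Longrightarrow> g y = f y"
    using ANE_wrt_transfer[OF _ inj_on_subset metrY clC] by (metis subset_UNIV)
  obtain V where V: "openin P V" "U = V \<inter> {((m, \<tau>), t). \<tau> > 0 \<or> m \<in> A}"
    using U(1) unfolding Y_def openin_subtopology by blast
  \<comment> \<open>The \<open>(m, \<tau>)\<close> whose whole segment in \<open>t\<close> lies in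
    \<open>V\<close>. Points with \<open>\<tau> = 0\<close> outside \<open>A\<close> may occur here,
    which is harmless: only heights \<open>\<delta> m > 0\<close> are used, where \<open>V\<close>
    and \<open>U\<close> agree.\<close>
  define G where "G = {q \<in> topspace (prod_topology M unit_top). \<forall>t\<in>{0..1}. (q, t) \<in> V}"
  have "openin (prod_topology M unit_top) G"
    unfolding G_def using V(1) unfolding P_def
    by (rule openin_slices) (simp add: compactin_subtopology)
  then obtain \<delta> where \<delta>: "continuous_map M euclideanreal \<delta>"
    "\<And>m. m \<in> topspace M \<Longrightarrow> 0 \<le> \<delta> m \<and> \<delta> m \<le> 1"
    "\<And>m. (m, 0) \<in> G \<Longrightarrow> 0 < \<delta> m"
    "\<And>m. \<lbrakk>m \<in> topspace M; 0 < \<delta> m\<rbrakk> \<Longrightarrow> (m, \<delta> m) \<in> G"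
    using collar_function[OF metrM] by blast
  define W where "W = {m \<in> topspace M. \<delta> m \<in> {0<..}}"
  \<comment> \<open>The extension \<open>g\<close> read along the graph of
    \<open>\<delta>\<close>.\<close>
  define s' where "s' = (\<lambda>m t. if t \<in> {0..1} then (g \<circ> (\<lambda>(m, t). ((m, \<delta> m), t))) (m, t) else undefined)"
  have inY: "((m, \<delta> m), t) \<in> topspace Y" if "m \<in> W" "t \<in> {0..1}" for m t
    using that \<delta>(2) by (auto simp: W_def topY)
  have inU: "((m, \<delta> m), t) \<in> U" if "m \<in> W" "t \<in> {0..1}" for m t
    using that \<delta>(4) by (auto simp: W_def V(2) G_def)
  \<comment> \<open>On the graph \<open>\<tau> = \<delta> m\<close> is positive, so \<open>f\<close>
    takes its end point values there and not those of \<open>s\<close>.\<close>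
  have g_bd: "g ((m, \<delta> m), t) = (if t = 1 then snd m else fst m)"
    if "m \<in> W" "t \<in> {0..1}" "t = 0 \<or> t = 1 \<or> m \<in> diag X" for m t
  proof -
    have "((m, \<delta> m), t) \<in> C"
      using inY[OF that(1,2)] that(3) by (auto simp: C_def T_def)
    then show ?thesis
      using g that(1) by (auto simp: f_def W_def)
  qed
  show thesis
  proof
    show "openin (prod_topology X X) W"
      using \<delta>(1) unfolding W_def M_def[symmetric]
      by (rule openin_continuous_map_preimage) auto
    show "A \<subseteq> W"
    proof
      fix a assume a: "a \<in> A"
      \<comment> \<open>Over \<open>A\<close> the whole bottom segment belongs to \<open>C\<close>,
        hence to \<open>U\<close>, which forces \<open>\<delta> a > 0\<close>.\<close>
      then have "((a, 0), t) \<in> C" if "t \<in> {0..1}" for t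
        using that A by (auto simp: C_def T_def topY M_def)
      then have "(a, 0) \<in> G"
        using a A U(2) by (auto simp: G_def V(2) M_def)
      then show "a \<in> W"
        using a A \<delta>(3) by (auto simp: W_def M_def)
    qed
    have "continuous_map (prod_topology (subtopology M W) unit_top) (subtopology Y U)
        (\<lambda>(m, t). ((m, \<delta> m), t))"
    proof -
      have fst: "continuous_map (prod_topology (subtopology M W) unit_top) M fst"
        by (metis continuous_map_fst continuous_map_into_fulltopology)
      moreover from fst have "continuous_map (prod_topology (subtopology M W) unit_top) unit_top (\<delta> \<circ> fst)"
        using \<delta>(1,2)
        by (intro continuous_map_into_subtopology continuous_map_compose[OF fst]) (auto simp: W_def)
      ultimately have "continuous_map (prod_topology (subtopology M W) unit_top) P
          (\<lambda>p. ((fst p, (\<delta> \<circ> fst) p), snd p))"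
        unfolding P_def by (intro continuous_map_pairedI continuous_map_snd)
      then have "continuous_map (prod_topology (subtopology M W) unit_top) P
          (\<lambda>(m, t). ((m, \<delta> m), t))"
        by (rule continuous_map_eq) auto
      then show ?thesis
        unfolding Y_def using inU
        by (intro continuous_map_into_subtopology) (auto simp: W_def)
    qed
    then have "continuous_map (subtopology M W) (path_space X) s'"
      unfolding s'_def by (intro continuous_map_curry_path_space continuous_map_compose[OF _ U(3)])
    moreover have "s' (x, y) 0 = x \<and> s' (x, y) 1 = y" if "(x, y) \<in> W" for x y
      using that g_bd by (auto simp: s'_def)
    moreover have "s' (x, x) = const_path x" if "(x, x) \<in> W" for x
    proof -
      have "(x, x) \<in> diag X"
        using that by (auto simp: W_def M_def diag_def)
      then show ?thesis
        using that g_bd by (auto simp: s'_def const_path_def fun_eq_iff)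
    qed
    ultimately show "rel_section X W s'"
      by (simp add: rel_section_def motion_section_def M_def)
  qed
qed

lemma motion_section_const_path:
  "motion_section X (diag X) (\<lambda>(x, y). const_path x)"
proof -
  have "continuous_map (prod_topology (subtopology (prod_topology X X) (diag X)) unit_top) X (fst \<circ> fst)"
    by (metis continuous_map_compose continuous_map_fst continuous_map_from_subtopology)
  then have "continuous_map (subtopology (prod_topology X X) (diag X)) (path_space X)
      (\<lambda>z t. if t \<in> {0..1} then (fst \<circ> fst) (z, t) else undefined)"
    by (rule continuous_map_curry_path_space)
  then have "continuous_map (subtopology (prod_topology X X) (diag X)) (path_space X)
      (\<lambda>(x, y). const_path x)"
    by (rule continuous_map_eq) (auto simp: const_path_def)
  then show ?thesis
    by (auto simp: motion_section_def diag_def const_path_def)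
qed

text \<open>Both pieces are closed, and on their overlap the normalisation makes \<open>s\<close> a
  constant path, so they paste.\<close>

lemma rel_section_Un_diag:
  assumes X: "metrizable_space X" and C: "closedin (prod_topology X X) C" and s: "rel_section X C s"
  shows "rel_section X (C \<union> diag X) (\<lambda>p. if p \<in> diag X then const_path (fst p) else s p)"
    (is "rel_section X _ ?s")
proof -
  let ?M = "prod_topology X X"
  have "continuous_map (subtopology ?M (C \<union> diag X)) (path_space X) ?s"
  proof (rule pasting_lemma_closed[where I="{True, False}" and T="\<lambda>b. if b then diag X else C"
        and f="\<lambda>b. if b then (\<lambda>(x, y). const_path x) else s"])
    show "closedin (subtopology ?M (C \<union> diag X)) (if b then diag X else C)" for b
      using C closedin_diag[OF X] by (intro closedin_subset_topspace) auto
    show "continuous_map (subtopology (subtopology ?M (C \<union> diag X)) (if b then diag X else C))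
        (path_space X) (if b then (\<lambda>(x, y). const_path x) else s)" for b
      using s motion_section_const_path[of X]
      by (simp add: subtopology_subtopology rel_section_def motion_section_def Int_absorb1)
    show "(if b then (\<lambda>(x, y). const_path x) else s) p = (if c then (\<lambda>(x, y). const_path x) else s) p"
      if "p \<in> topspace (subtopology ?M (C \<union> diag X)) \<inter> (if b then diag X else C) \<inter>
        (if c then diag X else C)" for b c p
      using that s by (auto simp: rel_section_def diag_def split: if_splits)
    show "\<exists>b. b \<in> {True, False} \<and> p \<in> (if b then diag X else C) \<and>
        ?s p = (if b then (\<lambda>(x, y). const_path x) else s) p"
      if "p \<in> topspace (subtopology ?M (C \<union> diag X))" for p
      using that by (intro exI[of _ "p \<in> diag X"]) (auto split: prod.split)
  qed auto
  then show ?thesis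
    using s unfolding rel_section_def motion_section_def
    by (simp add: const_path_def diag_def)
qed

subsection \<open>The invariants\<close>

lemma rel_section_iff_diag_subset:
  assumes "A \<subseteq> topspace (prod_topology X X)" "diag X \<subseteq> A"
  shows "rel_section X A s \<longleftrightarrow> motion_section X A s \<and> (\<forall>x\<in>topspace X. s (x, x) = const_path x)"
  using assms by (auto simp: rel_section_def diag_def)

lemma rel_section_M_iff:
  assumes "is_cover X n U" "\<forall>i\<le>n. diag X \<subseteq> U i"
  shows "(\<forall>i\<le>n. rel_section X (U i) (s i)) \<longleftrightarrow>
    (\<forall>i\<le>n. motion_section X (U i) (s i) \<and> (\<forall>x\<in>topspace X. s i (x, x) = const_path x))"
  using assms rel_section_iff_diag_subset[of "U i" X "s i" for i] by (simp add: is_cover_def)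

lemma rel_section_iff_diag_disjoint:
  assumes "A \<subseteq> topspace (prod_topology X X)" "diag X \<inter> A = {}"
  shows "rel_section X A s \<longleftrightarrow> motion_section X A s"
  using assms by (fastforce simp: rel_section_def diag_def)

text \<open>In terms of \<open>rel_section\<close>, the open and the general version of an invariant
  differ by a single final conjunct, so one direction of each comparison is immediate.\<close>

lemma TC_M_alt:
  "TC_M X = least_enat (\<lambda>n. \<exists>U s. is_cover X n U \<and> (\<forall>i\<le>n. diag X \<subseteq> U i \<and> rel_section X (U i) (s i)) \<and>
     (\<forall>i\<le>n. openin (prod_topology X X) (U i)))"
  unfolding TC_M_def
  apply (intro arg_cong[where f=least_enat] ext iff_exI)
  subgoal for n U s
    using rel_section_M_iff[of X n U s] by blast
  done

lemma TC_M_g_alt: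
  "TC_M_g X = least_enat (\<lambda>n. \<exists>U s. is_cover X n U \<and> (\<forall>i\<le>n. diag X \<subseteq> U i \<and> rel_section X (U i) (s i)))"
  unfolding TC_M_g_def
  apply (intro arg_cong[where f=least_enat] ext iff_exI)
  subgoal for n U s
    using rel_section_M_iff[of X n U s] by blast
  done

lemma TC_DM_alt:
  "TC_DM X = least_enat (\<lambda>n. \<exists>U s. is_cover X n U \<and>
     (\<forall>i\<le>n. openin (prod_topology X X) (U i) \<and> rel_section X (U i) (s i)))"
  unfolding TC_DM_def rel_section_def ..

text \<open>The normalisation has content only at index 0, as the other sets miss the
  diagonal.\<close>

lemma rel_section_FH_iff:
  assumes "is_cover X n U" "diag X \<subseteq> U 0" "\<forall>i. 1 \<le> i \<and> i \<le> n \<longrightarrow> diag X \<inter> U i = {}"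
  shows "(\<forall>i\<le>n. rel_section X (U i) (s i)) \<longleftrightarrow>
    (\<forall>i\<le>n. motion_section X (U i) (s i)) \<and> (\<forall>x\<in>topspace X. s 0 (x, x) = const_path x)"
proof -
  have U: "U i \<subseteq> topspace (prod_topology X X)" if "i \<le> n" for i
    using assms(1) that by (simp add: is_cover_def)
  have "rel_section X (U i) (s i) \<longleftrightarrow>
      motion_section X (U i) (s i) \<and> (i = 0 \<longrightarrow> (\<forall>x\<in>topspace X. s 0 (x, x) = const_path x))"
    if "i \<le> n" for i
    using that assms(3) rel_section_iff_diag_disjoint[OF U[OF that], of "s i"]
      rel_section_iff_diag_subset[OF U[of 0] assms(2), of "s 0"] by (cases "i = 0") auto
  then show ?thesis
    by auto
qed

lemma TC_FH_alt:
  "TC_FH X = least_enat (\<lambda>n. \<exists>U s. is_cover X n U \<and> (\<forall>i\<le>n. rel_section X (U i) (s i)) \<and>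
     diag X \<subseteq> U 0 \<and> (\<forall>i. 1 \<le> i \<and> i \<le> n \<longrightarrow> diag X \<inter> U i = {}) \<and>
     (\<forall>i\<le>n. openin (prod_topology X X) (U i)))"
  unfolding TC_FH_def
  apply (intro arg_cong[where f=least_enat] ext iff_exI)
  subgoal for n U s
    using rel_section_FH_iff[of X n U s] by blast
  done

lemma TC_FH_g_alt:
  "TC_FH_g X = least_enat (\<lambda>n. \<exists>U s. is_cover X n U \<and> (\<forall>i\<le>n. rel_section X (U i) (s i)) \<and>
     diag X \<subseteq> U 0 \<and> (\<forall>i. 1 \<le> i \<and> i \<le> n \<longrightarrow> diag X \<inter> U i = {}))"
  unfolding TC_FH_g_def
  apply (intro arg_cong[where f=least_enat] ext iff_exI)
  subgoal for n U s
    using rel_section_FH_iff[of X n U s] by blast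
  done

section \<open>Openness of the covers is irrelevant\<close>

lemma rel_section_cover_open_extension:
  assumes X: "ANR_space X" and U: "is_cover X n U" and s: "\<forall>i\<le>n. rel_section X (U i) (s i)"
  obtains W s' where "\<And>i. i \<le> n \<Longrightarrow> openin (prod_topology X X) (W i)" "\<And>i. i \<le> n \<Longrightarrow> U i \<subseteq> W i"
    "\<And>i. i \<le> n \<Longrightarrow> rel_section X (W i) (s' i)"
proof -
  have "\<exists>W s'. openin (prod_topology X X) W \<and> U i \<subseteq> W \<and> rel_section X W s'" if i: "i \<le> n" for i
  proof -
    have "U i \<subseteq> topspace (prod_topology X X)" "rel_section X (U i) (s i)"
      using U s i by (auto simp: is_cover_def)
    then show ?thesis
      by (rule rel_section_open_extension[OF X]) blast
  qed
  then obtain W s' where "\<forall>i\<le>n. openin (prod_topology X X) (W i) \<and> U i \<subseteq> W i \<and> rel_section X (W i) (s' i)"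
    by metis
  then show thesis
    by (intro that[of W s']) auto
qed

lemma is_cover_mono:
  assumes "is_cover X n U" "\<And>i. i \<le> n \<Longrightarrow> U i \<subseteq> W i"
    "\<And>i. i \<le> n \<Longrightarrow> W i \<subseteq> topspace (prod_topology X X)"
  shows "is_cover X n W"
proof -
  have "(\<Union>i\<le>n. U i) \<subseteq> (\<Union>i\<le>n. W i)"
    using assms(2) by (intro UN_mono) auto
  moreover have "(\<Union>i\<le>n. W i) \<subseteq> topspace (prod_topology X X)"
    using assms(3) by (intro UN_least) auto
  ultimately show ?thesis
    using assms(1,3) unfolding is_cover_def by blast
qed

lemma diag_subset: "diag X \<subseteq> topspace (prod_topology X X)"
  by (auto simp: diag_def)

lemma TC_M_g_eq_TC_M:
  assumes X: "ANR_space X"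
  shows "TC_M_g X = TC_M X"
  unfolding TC_M_alt TC_M_g_alt
proof (intro arg_cong[where f=least_enat] ext iffI; elim exE conjE)
  fix n U s
  assume U: "is_cover X n U" and s: "\<forall>i\<le>n. diag X \<subseteq> U i \<and> rel_section X (U i) (s i)"
  from s have "\<forall>i\<le>n. rel_section X (U i) (s i)"
    by blast
  then obtain W s' where W: "\<And>i. i \<le> n \<Longrightarrow> openin (prod_topology X X) (W i)"
    "\<And>i. i \<le> n \<Longrightarrow> U i \<subseteq> W i" "\<And>i. i \<le> n \<Longrightarrow> rel_section X (W i) (s' i)"
    using rel_section_cover_open_extension[OF X U] by blast
  then have "is_cover X n W"
    using U by (blast intro: is_cover_mono dest: openin_subset)
  then show "\<exists>U s. is_cover X n U \<and> (\<forall>i\<le>n. diag X \<subseteq> U i \<and> rel_section X (U i) (s i)) \<and>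
      (\<forall>i\<le>n. openin (prod_topology X X) (U i))"
    using W s by (intro exI[of _ W] exI[of _ s']) blast
qed blast

lemma TC_FH_g_eq_TC_FH:
  assumes X: "ANR_space X"
  shows "TC_FH_g X = TC_FH X"
  unfolding TC_FH_alt TC_FH_g_alt
proof (intro arg_cong[where f=least_enat] ext iffI; elim exE conjE)
  fix n U s
  assume U: "is_cover X n U" "diag X \<subseteq> U 0" "\<forall>i. 1 \<le> i \<and> i \<le> n \<longrightarrow> diag X \<inter> U i = {}"
    and s: "\<forall>i\<le>n. rel_section X (U i) (s i)"
  obtain W s' where W: "\<And>i. i \<le> n \<Longrightarrow> openin (prod_topology X X) (W i)"
    "\<And>i. i \<le> n \<Longrightarrow> U i \<subseteq> W i" "\<And>i. i \<le> n \<Longrightarrow> rel_section X (W i) (s' i)"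
    using rel_section_cover_open_extension[OF X U(1) s] by blast
  \<comment> \<open>An enlarged set may run into the diagonal. Removing the closed diagonal at
    positive indices keeps the set open and loses nothing of \<open>U i\<close>, which was disjoint
    from it.\<close>
  define W' where "W' i = (if i = 0 then W 0 else W i - diag X)" for i
  have W': "openin (prod_topology X X) (W' i)" "U i \<subseteq> W' i" "rel_section X (W' i) (s' i)"
    if "i \<le> n" for i
  proof -
    have "closedin (prod_topology X X) (diag X)"
      using X by (simp add: ANR_space_def closedin_diag)
    then show "openin (prod_topology X X) (W' i)"
      using W(1)[of i] W(1)[of 0] that by (auto simp: W'_def intro: openin_diff)
    have "diag X \<inter> U i = {}" if "i \<noteq> 0"
      using U(3) that \<open>i \<le> n\<close> by simp
    then show "U i \<subseteq> W' i"
      using W(2)[OF that] by (auto simp: W'_def)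
    show "rel_section X (W' i) (s' i)"
      using W(3)[OF that] by (rule rel_section_subset) (auto simp: W'_def)
  qed
  then have "is_cover X n W'"
    using U(1) by (blast intro: is_cover_mono dest: openin_subset)
  moreover have "diag X \<subseteq> W' 0" "\<forall>i. 1 \<le> i \<and> i \<le> n \<longrightarrow> diag X \<inter> W' i = {}"
    using U(2) W'(2)[of 0] by (auto simp: W'_def)
  ultimately show "\<exists>U s. is_cover X n U \<and> (\<forall>i\<le>n. rel_section X (U i) (s i)) \<and>
     diag X \<subseteq> U 0 \<and> (\<forall>i. 1 \<le> i \<and> i \<le> n \<longrightarrow> diag X \<inter> U i = {}) \<and>
     (\<forall>i\<le>n. openin (prod_topology X X) (U i))"
    using W' by blast
qed blast

section \<open>Comparison with \<open>TC_DM\<close> through closed covers\<close>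

lemma closed_rel_section_cover:
  assumes X: "metrizable_space X" and U: "is_cover X n U"
    and s: "\<forall>i\<le>n. openin (prod_topology X X) (U i) \<and> rel_section X (U i) (s i)"
  obtains C s' where "is_cover X n C" "\<And>i. i \<le> n \<Longrightarrow> rel_section X (C i \<union> diag X) (s' i)"
proof -
  have "metrizable_space (prod_topology X X)"
    using X by (simp add: metrizable_space_prod_topology)
  moreover have "openin (prod_topology X X) (U i)" if "i \<le> n" for i
    using s that by blast
  moreover have "topspace (prod_topology X X) \<subseteq> (\<Union>i\<le>n. U i)"
    using U by (simp add: is_cover_def)
  ultimately obtain C where C: "\<And>i. i \<le> n \<Longrightarrow> closedin (prod_topology X X) (C i)"
    "\<And>i. i \<le> n \<Longrightarrow> C i \<subseteq> U i" "(\<Union>i\<le>n. C i) = topspace (prod_topology X X)"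
    by (rule closed_shrinking) blast+
  then have "is_cover X n C"
    unfolding is_cover_def by blast
  \<comment> \<open>This gluing is the purpose of the shrinking: over the open \<open>U i\<close>
    the pasted map need not be continuous.\<close>
  moreover have "rel_section X (C i \<union> diag X) (\<lambda>p. if p \<in> diag X then const_path (fst p) else s i p)"
    if "i \<le> n" for i
    using C that s by (intro rel_section_Un_diag X) (blast intro: rel_section_subset)+
  ultimately show thesis
    by (rule that)
qed

lemma least_enat_mono:
  assumes "\<And>n. P n \<Longrightarrow> Q n"
  shows "least_enat Q \<le> least_enat P"
proof (cases "\<exists>n. P n")
  case True
  then have "Q (LEAST n. P n)"
    using LeastI_ex assms by blast
  then show ?thesis
    using True by (auto simp: least_enat_def intro: Least_le)
qed (simp add: least_enat_def)

lemma TC_M_g_le_TC_DM: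
  assumes X: "metrizable_space X"
  shows "TC_M_g X \<le> TC_DM X"
  unfolding TC_M_g_alt TC_DM_alt
proof (rule least_enat_mono; elim exE conjE)
  fix n U s
  assume U: "is_cover X n U"
    and s: "\<forall>i\<le>n. openin (prod_topology X X) (U i) \<and> rel_section X (U i) (s i)"
  obtain C s' where C: "is_cover X n C"
    "\<And>i. i \<le> n \<Longrightarrow> rel_section X (C i \<union> diag X) (s' i)"
    using closed_rel_section_cover[OF X U s] by blast
  have "is_cover X n (\<lambda>i. C i \<union> diag X)"
    using C(1) by (rule is_cover_mono) (use C(1) diag_subset in \<open>auto simp: is_cover_def\<close>)
  then show "\<exists>U s. is_cover X n U \<and> (\<forall>i\<le>n. diag X \<subseteq> U i \<and> rel_section X (U i) (s i))"
    using C(2) by (intro exI[of _ "\<lambda>i. C i \<union> diag X"] exI[of _ s']) auto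
qed

lemma TC_FH_g_le_TC_DM:
  assumes X: "metrizable_space X"
  shows "TC_FH_g X \<le> TC_DM X"
  unfolding TC_FH_g_alt TC_DM_alt
proof (rule least_enat_mono; elim exE conjE)
  fix n U s
  assume U: "is_cover X n U"
    and s: "\<forall>i\<le>n. openin (prod_topology X X) (U i) \<and> rel_section X (U i) (s i)"
  obtain C s' where C: "is_cover X n C"
    "\<And>i. i \<le> n \<Longrightarrow> rel_section X (C i \<union> diag X) (s' i)"
    using closed_rel_section_cover[OF X U s] by blast
  \<comment> \<open>The diagonal is moved entirely into the set of index 0. What the other
    \<open>C i\<close> lose is covered there.\<close>
  define D where "D i = (if i = 0 then C 0 \<union> diag X else C i - diag X)" for i
  have "D i \<subseteq> C i \<union> diag X" for i
    by (auto simp: D_def)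
  then have "\<forall>i\<le>n. rel_section X (D i) (s' i)"
    using C(2) rel_section_subset by blast
  moreover have "is_cover X n D"
    unfolding is_cover_def
  proof (intro conjI subset_antisym)
    show D: "\<forall>i\<le>n. D i \<subseteq> topspace (prod_topology X X)"
      using C(1) diag_subset[of X] unfolding is_cover_def D_def by auto
    then show "(\<Union>i\<le>n. D i) \<subseteq> topspace (prod_topology X X)"
      by blast
    have "C i \<subseteq> D i \<union> D 0" for i
      by (auto simp: D_def)
    then have "(\<Union>i\<le>n. C i) \<subseteq> (\<Union>i\<le>n. D i)"
      by blast
    then show "topspace (prod_topology X X) \<subseteq> (\<Union>i\<le>n. D i)"
      using C(1) by (simp add: is_cover_def)
  qed
  moreover have "diag X \<subseteq> D 0" "\<forall>i. 1 \<le> i \<and> i \<le> n \<longrightarrow> diag X \<inter> D i = {}"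
    by (auto simp: D_def)
  ultimately show "\<exists>U s. is_cover X n U \<and> (\<forall>i\<le>n. rel_section X (U i) (s i)) \<and>
     diag X \<subseteq> U 0 \<and> (\<forall>i. 1 \<le> i \<and> i \<le> n \<longrightarrow> diag X \<inter> U i = {})"
    by blast
qed

lemma TC_DM_le_TC_M: "TC_DM X \<le> TC_M X"
  unfolding TC_DM_alt TC_M_alt by (rule least_enat_mono) blast

lemma TC_DM_le_TC_FH: "TC_DM X \<le> TC_FH X"
  unfolding TC_DM_alt TC_FH_alt by (rule least_enat_mono) blast

theorem theorem1p3:
  fixes X :: "'a topology"
  assumes "ANR_space X" and "path_connected_space X"
  shows "TC_FH X = TC_FH_g X \<and> TC_FH_g X = TC_DM X \<and> TC_DM X = TC_M X \<and> TC_M X = TC_M_g X"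
proof -
  have X: "metrizable_space X"
    using assms(1) by (simp add: ANR_space_def)
  \<comment> \<open>Two cycles close: \<open>TC_DM \<le> TC_M = TC_M_g \<le> TC_DM\<close>, and
    likewise with \<open>TC_FH\<close> and \<open>TC_FH_g\<close>.\<close>
  show ?thesis
    using TC_M_g_le_TC_DM[OF X] TC_FH_g_le_TC_DM[OF X] TC_DM_le_TC_M[of X] TC_DM_le_TC_FH[of X]
      TC_M_g_eq_TC_M[OF assms(1)] TC_FH_g_eq_TC_FH[OF assms(1)] by simp
qed

end
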